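(* Let $\mathcal L\in\{\mathbf{nbIciw},\mathbf{nbIci},\mathbf{nbIcl}\}$. For every set of formulas $\Gamma\cup\{\varphi\}\subseteq \mathbf{F}(\Sigma_{\mathbf{nbI}},\mathcal V)$: if $\Gamma\vdash_{\mathcal L}\varphi$ then $\Gamma\Vdash^{\mathcal L}_{\mathcal F}\varphi$.
   Context: Let $\mathcal V$ be a countable set of propositional variables and $\Sigma_{\mathbf{nbI}}=\{\vee,\wedge,\rightarrow,\uparrow,\neg\}$ with $\neg$ unary and the other connectives binary; $\mathbf F(\Sigma_{\mathbf{nbI}},\mathcal V)$ is the set of formulas. The logic $\mathbf{nbI}$ is the Hilbert calculus whose only inference rule is Modus Ponens and whose axioms are all instances (with arbitrary formulas) of: (1) $\alpha\to(\beta\to\alpha)$; (2) $(\alpha\to(\beta\to\gamma))\to((\alpha\to\beta)\to(\alpha\to\gamma))$; (3) $\alpha\to(\beta\to(\alpha\wedge\beta))$; (4) $(\alpha\wedge\beta)\to\alpha$; (5) $(\alpha\wedge\beta)\to\beta$; (6) $\alpha\to(\alpha\vee\beta)$; (7) $\beta\to(\alpha\vee\beta)$; (8) $(\alpha\to\gamma)\to((\beta\to\gamma)\to((\alpha\vee\beta)\to\gamma))$; (9) $(\alpha\to\beta)\vee\alpha$; (Ip) $(\alpha\uparrow\beta)\to(\alpha\to(\beta\to\gamma))$; (Comm) $(\alpha\uparrow\beta)\to(\beta\uparrow\alpha)$; (11) $\alpha\vee\neg\alpha$. The logics $\mathbf{nbIciw}$, $\mathbf{nbIci}$, $\mathbf{nbIcl}$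 are obtained from $\mathbf{nbI}$ by adding, respectively, all instances of $(\alpha\uparrow\neg\alpha)\vee(\alpha\wedge\neg\alpha)$; of $\neg(\alpha\uparrow\neg\alpha)\to(\alpha\wedge\neg\alpha)$; of $\neg(\alpha\wedge\neg\alpha)\to(\alpha\uparrow\neg\alpha)$. $\Gamma\vdash_{\mathcal L}\varphi$ means that there is a finite derivation of $\varphi$ from premises in $\Gamma$ in the calculus of $\mathcal L$. A $\Sigma$-multialgebra on a nonempty set $A$ interprets each $n$-ary connective $\sigma$ as a function $\sigma_{\mathcal A}:A^n\to\wp(A)\setminus\{\emptyset\}$; an operation with only singleton values is identified with an ordinary operation; a multioperation applied to a set means the union of its values on the elements of the set. A valuation over $\mathcal A$ is a map $\nu$ from formulas to $A$ with $\nu(\sigma(\varphi_1,\dots,\varphi_n))\in\sigma_{\mathcal A}(\nu(\varphi_1),\dots,\nu(\varphi_n))$ for all connectives $\sigma$ and formulas $\varphi_i$. An RNmatrix (restricted non-deterministic matrix) for $\mathcal L$ is a triple $(\mathcal A,D,\mathcal F)$ where: - $\mathcal A$ is a $\Sigma_{\mathbf{nbI}}$-multialgebra with universe $A$ in which $\wedge,\vee,\to$ are ordinary operations making $A$ a Boolean algebra with bottom $0$, top $1$ (with $\to$ the Boolean implication) and Boolean complement ${\sim}a=a\to0$, and such that for all $a,b,c\in A$: $a\uparrow b=b\uparrow a$ (as sets); if $c\in a\uparrow b$ then $a\wedge b\wedge c=0$; if $b\in\neg a$ then $a\vee b=1$; if $b\in\neg a$ then ${\sim}(a\wedge b)\in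 a\uparrow b$; if $\mathcal L=\mathbf{nbIci}$: $b\in\neg a$ implies $a\wedge b\in\neg(a\uparrow b)$; if $\mathcal L=\mathbf{nbIcl}$: $b\in\neg a$ implies ${\sim}(a\wedge b)\in\neg(a\wedge b)$; - $D=\{1\}$ (designated elements; $D$ is a proper subset of $A$, i.e. $0\ne1$); - $\mathcal F$ is the set of all valuations $\nu$ over $\mathcal A$ such that for all formulas $\alpha,\beta$: $\nu(\alpha\uparrow\beta)=\nu(\beta\uparrow\alpha)$; $\nu(\alpha\uparrow\neg\alpha)={\sim}(\nu(\alpha)\wedge\nu(\neg\alpha))$; if $\mathcal L=\mathbf{nbIci}$: $\nu(\neg(\alpha\uparrow\neg\alpha))=\nu(\alpha)\wedge\nu(\neg\alpha)$; if $\mathcal L=\mathbf{nbIcl}$: $\nu(\alpha\uparrow\neg\alpha)=\nu(\neg(\alpha\wedge\neg\alpha))$. $\Gamma\Vdash^{\mathcal L}_{\mathcal F}\varphi$ means: for every RNmatrix $(\mathcal A,D,\mathcal F)$ for $\mathcal L$ and every $\nu\in\mathcal F$, if $\nu(\gamma)\in D$ for all $\gamma\in\Gamma$ then $\nu(\varphi)\in D$. *)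

theory Defs
  imports Main "HOL-Library.Countable"
begin

datatype 'v form =
    Var 'v
  | Or "'v form" "'v form"  (infixr "\<^bold>\<or>" 65)
  | And "'v form" "'v form"  (infixr "\<^bold>\<and>" 70)
  | Imp "'v form" "'v form"  (infixr "\<^bold>\<rightarrow>" 60)
  | Up "'v form" "'v form"  (infix "\<^bold>\<up>" 75)
  | Neg "'v form"  ("\<^bold>\<not> _" [80] 80)

datatype logic = NbIciw | NbIci | NbIcl

inductive nbI_axiom :: "'v form \<Rightarrow> bool" where
  Ax1: "nbI_axiom (\<alpha> \<^bold>\<rightarrow> (\<beta> \<^bold>\<rightarrow> \<alpha>))"
| Ax2: "nbI_axiom ((\<alpha> \<^bold>\<rightarrow> (\<beta> \<^bold>\<rightarrow> \<gamma>)) \<^bold>\<rightarrow> ((\<alpha> \<^bold>\<rightarrow> \<beta>) \<^bold>\<rightarrow> (\<alpha> \<^bold>\<rightarrow> \<gamma>)))"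
| Ax3: "nbI_axiom (\<alpha> \<^bold>\<rightarrow> (\<beta> \<^bold>\<rightarrow> (\<alpha> \<^bold>\<and> \<beta>)))"
| Ax4: "nbI_axiom ((\<alpha> \<^bold>\<and> \<beta>) \<^bold>\<rightarrow> \<alpha>)"
| Ax5: "nbI_axiom ((\<alpha> \<^bold>\<and> \<beta>) \<^bold>\<rightarrow> \<beta>)"
| Ax6: "nbI_axiom (\<alpha> \<^bold>\<rightarrow> (\<alpha> \<^bold>\<or> \<beta>))"
| Ax7: "nbI_axiom (\<beta> \<^bold>\<rightarrow> (\<alpha> \<^bold>\<or> \<beta>))"
| Ax8: "nbI_axiom ((\<alpha> \<^bold>\<rightarrow> \<gamma>) \<^bold>\<rightarrow> ((\<beta> \<^bold>\<rightarrow> \<gamma>) \<^bold>\<rightarrow> ((\<alpha> \<^bold>\<or> \<beta>) \<^bold>\<rightarrow> \<gamma>)))"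
| Ax9: "nbI_axiom ((\<alpha> \<^bold>\<rightarrow> \<beta>) \<^bold>\<or> \<alpha>)"
| Ip: "nbI_axiom ((\<alpha> \<^bold>\<up> \<beta>) \<^bold>\<rightarrow> (\<alpha> \<^bold>\<rightarrow> (\<beta> \<^bold>\<rightarrow> \<gamma>)))"
| Comm: "nbI_axiom ((\<alpha> \<^bold>\<up> \<beta>) \<^bold>\<rightarrow> (\<beta> \<^bold>\<up> \<alpha>))"
| Ax11: "nbI_axiom (\<alpha> \<^bold>\<or> \<^bold>\<not> \<alpha>)"

inductive is_axiom :: "logic \<Rightarrow> 'v form \<Rightarrow> bool" where
  nbI: "nbI_axiom \<phi> \<Longrightarrow> is_axiom L \<phi>"
| ciw: "is_axiom NbIciw ((\<alpha> \<^bold>\<up> \<^bold>\<not> \<alpha>) \<^bold>\<or> (\<alpha> \<^bold>\<and> \<^bold>\<not> \<alpha>))"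
| ci: "is_axiom NbIci (\<^bold>\<not> (\<alpha> \<^bold>\<up> \<^bold>\<not> \<alpha>) \<^bold>\<rightarrow> (\<alpha> \<^bold>\<and> \<^bold>\<not> \<alpha>))"
| cl: "is_axiom NbIcl (\<^bold>\<not> (\<alpha> \<^bold>\<and> \<^bold>\<not> \<alpha>) \<^bold>\<rightarrow> (\<alpha> \<^bold>\<up> \<^bold>\<not> \<alpha>))"

definition derivation :: "logic \<Rightarrow> 'v form set \<Rightarrow> 'v form list \<Rightarrow> bool" where
  "derivation L \<Gamma> \<phi>s \<longleftrightarrow>
     (\<forall>i < length \<phi>s. \<phi>s ! i \<in> \<Gamma> \<or> is_axiom L (\<phi>s ! i) \<or>
        (\<exists>j < i. \<exists>k < i. \<phi>s ! k = (\<phi>s ! j \<^bold>\<rightarrow> \<phi>s ! i)))"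

definition derives :: "logic \<Rightarrow> 'v form set \<Rightarrow> 'v form \<Rightarrow> bool" where
  "derives L \<Gamma> \<phi> \<longleftrightarrow> (\<exists>\<phi>s. \<phi>s \<noteq> [] \<and> derivation L \<Gamma> \<phi>s \<and> last \<phi>s = \<phi>)"

record 'a multialg =
  univ :: "'a set"
  or_op :: "'a \<Rightarrow> 'a \<Rightarrow> 'a set"
  and_op :: "'a \<Rightarrow> 'a \<Rightarrow> 'a set"
  imp_op :: "'a \<Rightarrow> 'a \<Rightarrow> 'a set"
  up_op :: "'a \<Rightarrow> 'a \<Rightarrow> 'a set"
  neg_op :: "'a \<Rightarrow> 'a set"

definition multiop1 :: "'a set \<Rightarrow> ('a \<Rightarrow> 'a set) \<Rightarrow> bool" where
  "multiop1 A f \<longleftrightarrow> (\<forall>a\<in>A. f a \<subseteq> A \<and> f a \<noteq> {})"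

definition multiop2 :: "'a set \<Rightarrow> ('a \<Rightarrow> 'a \<Rightarrow> 'a set) \<Rightarrow> bool" where
  "multiop2 A f \<longleftrightarrow> (\<forall>a\<in>A. \<forall>b\<in>A. f a b \<subseteq> A \<and> f a b \<noteq> {})"

definition multialgebra :: "'a multialg \<Rightarrow> bool" where
  "multialgebra M \<longleftrightarrow> univ M \<noteq> {} \<and>
     multiop2 (univ M) (or_op M) \<and> multiop2 (univ M) (and_op M) \<and>
     multiop2 (univ M) (imp_op M) \<and> multiop2 (univ M) (up_op M) \<and>
     multiop1 (univ M) (neg_op M)"

definition ordinary :: "'a set \<Rightarrow> ('a \<Rightarrow> 'a \<Rightarrow> 'a set) \<Rightarrow> bool" where
  "ordinary A f \<longleftrightarrow> (\<forall>a\<in>A. \<forall>b\<in>A. is_singleton (f a b))"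

text \<open>The ordinary operation identified with a singleton-valued multioperation.\<close>

definition op_of :: "('a \<Rightarrow> 'a \<Rightarrow> 'a set) \<Rightarrow> 'a \<Rightarrow> 'a \<Rightarrow> 'a" where
  "op_of f a b = the_elem (f a b)"

definition valuation :: "'a multialg \<Rightarrow> ('v form \<Rightarrow> 'a) \<Rightarrow> bool" where
  "valuation M \<nu> \<longleftrightarrow> (\<forall>\<phi>. \<nu> \<phi> \<in> univ M) \<and>
     (\<forall>\<alpha> \<beta>. \<nu> (\<alpha> \<^bold>\<or> \<beta>) \<in> or_op M (\<nu> \<alpha>) (\<nu> \<beta>) \<and>
            \<nu> (\<alpha> \<^bold>\<and> \<beta>) \<in> and_op M (\<nu> \<alpha>) (\<nu> \<beta>) \<and>
            \<nu> (\<alpha> \<^bold>\<rightarrow> \<beta>) \<in> imp_op M (\<nu> \<alpha>) (\<nu> \<beta>) \<and>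
            \<nu> (\<alpha> \<^bold>\<up> \<beta>) \<in> up_op M (\<nu> \<alpha>) (\<nu> \<beta>)) \<and>
     (\<forall>\<alpha>. \<nu> (\<^bold>\<not> \<alpha>) \<in> neg_op M (\<nu> \<alpha>))"

text \<open>
  The carrier-set version of the library locale \<^locale>\<open>abstract_boolean_algebra\<close>, with the same
  axioms relativised to \<open>A\<close>; \<open>boolean_algebra_on_UNIV\<close> below states the agreement for \<open>A = UNIV\<close>.
\<close>

definition boolean_algebra_on ::
  "'a set \<Rightarrow> ('a \<Rightarrow> 'a \<Rightarrow> 'a) \<Rightarrow> ('a \<Rightarrow> 'a \<Rightarrow> 'a) \<Rightarrow> ('a \<Rightarrow> 'a) \<Rightarrow> 'a \<Rightarrow> 'a \<Rightarrow> bool" where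
  "boolean_algebra_on A meet join compl zero one \<longleftrightarrow>
     zero \<in> A \<and> one \<in> A \<and>
     (\<forall>a\<in>A. compl a \<in> A \<and>
        meet a one = a \<and> join a zero = a \<and>
        meet a (compl a) = zero \<and> join a (compl a) = one) \<and>
     (\<forall>a\<in>A. \<forall>b\<in>A. meet a b \<in> A \<and> join a b \<in> A \<and>
        meet a b = meet b a \<and> join a b = join b a) \<and>
     (\<forall>a\<in>A. \<forall>b\<in>A. \<forall>c\<in>A.
        meet (meet a b) c = meet a (meet b c) \<and>
        join (join a b) c = join a (join b c) \<and>
        meet a (join b c) = join (meet a b) (meet a c) \<and>
        join a (meet b c) = meet (join a b) (join a c))"

lemma boolean_algebra_on_UNIV:
  "boolean_algebra_on UNIV meet join compl zero one \<longleftrightarrow>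
   abstract_boolean_algebra meet join compl zero one"
  unfolding boolean_algebra_on_def abstract_boolean_algebra_def
    abstract_boolean_algebra_axioms_def abel_semigroup_def abel_semigroup_axioms_def semigroup_def
  by (simp; blast)

text \<open>
  The constants \<open>zero\<close> and \<open>one\<close> are not components of the triple \<open>(M, D, F)\<close>, but the conditions
  below determine them from \<open>M\<close>.
\<close>

definition boolean_reduct :: "'a multialg \<Rightarrow> 'a \<Rightarrow> 'a \<Rightarrow> bool" where
  "boolean_reduct M zero one \<longleftrightarrow>
     (let A = univ M; meet = op_of (and_op M); join = op_of (or_op M); imp = op_of (imp_op M);
          compl = (\<lambda>a. imp a zero)
      in ordinary A (and_op M) \<and> ordinary A (or_op M) \<and> ordinary A (imp_op M) \<and>
         boolean_algebra_on A meet join compl zero one \<and>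
         (\<forall>a\<in>A. \<forall>b\<in>A. imp a b = join (compl a) b))"

definition algebra_conditions :: "logic \<Rightarrow> 'a multialg \<Rightarrow> 'a \<Rightarrow> 'a \<Rightarrow> bool" where
  "algebra_conditions L M zero one \<longleftrightarrow>
     (let A = univ M; meet = op_of (and_op M); join = op_of (or_op M);
          compl = (\<lambda>a. op_of (imp_op M) a zero)
      in \<forall>a\<in>A. \<forall>b\<in>A.
           up_op M a b = up_op M b a \<and>
           (\<forall>c\<in>A. c \<in> up_op M a b \<longrightarrow> meet (meet a b) c = zero) \<and>
           (b \<in> neg_op M a \<longrightarrow> join a b = one) \<and>
           (b \<in> neg_op M a \<longrightarrow> compl (meet a b) \<in> up_op M a b) \<and>
           (L = NbIci \<longrightarrow> b \<in> neg_op M a \<longrightarrow> meet a b \<in> (\<Union>c \<in> up_op M a b. neg_op M c)) \<and>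
           (L = NbIcl \<longrightarrow> b \<in> neg_op M a \<longrightarrow> compl (meet a b) \<in> neg_op M (meet a b)))"

definition restricted_valuations :: "logic \<Rightarrow> 'a multialg \<Rightarrow> 'a \<Rightarrow> ('v form \<Rightarrow> 'a) set" where
  "restricted_valuations L M zero =
     (let meet = op_of (and_op M); compl = (\<lambda>a. op_of (imp_op M) a zero)
      in {\<nu>. valuation M \<nu> \<and>
            (\<forall>\<alpha> \<beta>. \<nu> (\<alpha> \<^bold>\<up> \<beta>) = \<nu> (\<beta> \<^bold>\<up> \<alpha>)) \<and>
            (\<forall>\<alpha>. \<nu> (\<alpha> \<^bold>\<up> \<^bold>\<not> \<alpha>) = compl (meet (\<nu> \<alpha>) (\<nu> (\<^bold>\<not> \<alpha>)))) \<and>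
            (L = NbIci \<longrightarrow> (\<forall>\<alpha>. \<nu> (\<^bold>\<not> (\<alpha> \<^bold>\<up> \<^bold>\<not> \<alpha>)) = meet (\<nu> \<alpha>) (\<nu> (\<^bold>\<not> \<alpha>)))) \<and>
            (L = NbIcl \<longrightarrow> (\<forall>\<alpha>. \<nu> (\<alpha> \<^bold>\<up> \<^bold>\<not> \<alpha>) = \<nu> (\<^bold>\<not> (\<alpha> \<^bold>\<and> \<^bold>\<not> \<alpha>))))})"

definition rnmatrix ::
  "logic \<Rightarrow> 'a multialg \<Rightarrow> 'a set \<Rightarrow> ('v form \<Rightarrow> 'a) set \<Rightarrow> bool" where
  "rnmatrix L M D F \<longleftrightarrow> multialgebra M \<and>
     (\<exists>zero one. boolean_reduct M zero one \<and> zero \<noteq> one \<and>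
        algebra_conditions L M zero one \<and>
        D = {one} \<and> F = restricted_valuations L M zero)"

text \<open>
  HOL cannot quantify over types inside a formula, so the type \<open>'a\<close> whose subsets serve as universes
  of the RNmatrices is an explicit parameter.
\<close>

definition entails :: "'a itself \<Rightarrow> logic \<Rightarrow> 'v form set \<Rightarrow> 'v form \<Rightarrow> bool" where
  "entails _ L \<Gamma> \<phi> \<longleftrightarrow>
     (\<forall>(M :: 'a multialg) D F. rnmatrix L M D F \<longrightarrow>
        (\<forall>\<nu>\<in>F. (\<forall>\<gamma>\<in>\<Gamma>. \<nu> \<gamma> \<in> D) \<longrightarrow> \<nu> \<phi> \<in> D))"

end

theory Submission
  imports Defs
begin

text \<open>
  Soundness holds because every theorem of the calculus is forced to the top of the Boolean algebra
  by an order-theoretic inequality. With \<open>a \<le> b\<close> for \<open>a \<and> b = a\<close>, an implication \<open>a \<rightarrow> b\<close> has value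
  \<open>1\<close> exactly when \<open>a \<le> b\<close>, and Boolean implication is residuated: \<open>c \<le> a \<rightarrow> b\<close> iff \<open>c \<and> a \<le> b\<close>
  (\<open>residuation\<close>). Hence modus ponens preserves the value \<open>1\<close>, and each axiom becomes one
  inequality between meets and joins.

  The connectives \<open>\<or>\<close>, \<open>\<and>\<close>, \<open>\<rightarrow>\<close> are deterministic, so a valuation is a homomorphism for them and
  the positive axioms are Boolean validities. For \<open>\<up>\<close> and \<open>\<not>\<close> the value of a compound formula is only
  known to lie in a set. The axioms about them split in two kinds. The explosion axiom and excluded
  middle follow from conditions that constrain \<^emph>\<open>every\<close> member of that set, so all valuations satisfy
  them. Commutativity of \<open>\<up>\<close> and the axiom distinguishing each logic depend on how the values of
  two formulas were chosen relative to each other, which membership in those sets does not settle;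
  the restrictions on valuations do, turning each such axiom into \<open>x \<rightarrow> x\<close> or \<open>\<sim>x \<or> x\<close>.
\<close>

section \<open>Order and residuation in a Boolean algebra on a carrier\<close>

text \<open>
  Complementation is \<open>\<lambda>a. imp a zero\<close> here, since an RNmatrix has implication, but no complement,
  among its operations.
\<close>

locale carrier_boolean_algebra =
  fixes A :: "'a set" and meet join imp :: "'a \<Rightarrow> 'a \<Rightarrow> 'a" and zero one :: 'a
  assumes boolean: "boolean_algebra_on A meet join (\<lambda>a. imp a zero) zero one"
    and imp_eq: "\<lbrakk>a \<in> A; b \<in> A\<rbrakk> \<Longrightarrow> imp a b = join (imp a zero) b"
begin

abbreviation compl :: "'a \<Rightarrow> 'a" where
  "compl a \<equiv> imp a zero"

definition le :: "'a \<Rightarrow> 'a \<Rightarrow> bool" where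
  "le a b \<longleftrightarrow> meet a b = a"

lemma zero_closed [simp]: "zero \<in> A"
  and one_closed [simp]: "one \<in> A"
  using boolean unfolding boolean_algebra_on_def by blast+

lemma compl_closed [simp]: "a \<in> A \<Longrightarrow> compl a \<in> A"
  and meet_one [simp]: "a \<in> A \<Longrightarrow> meet a one = a"
  and join_zero [simp]: "a \<in> A \<Longrightarrow> join a zero = a"
  and meet_compl [simp]: "a \<in> A \<Longrightarrow> meet a (compl a) = zero"
  and join_compl [simp]: "a \<in> A \<Longrightarrow> join a (compl a) = one"
  using boolean unfolding boolean_algebra_on_def by blast+

lemma meet_closed [simp]: "\<lbrakk>a \<in> A; b \<in> A\<rbrakk> \<Longrightarrow> meet a b \<in> A"
  and join_closed [simp]: "\<lbrakk>a \<in> A; b \<in> A\<rbrakk> \<Longrightarrow> join a b \<in> A"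
  and meet_commute: "\<lbrakk>a \<in> A; b \<in> A\<rbrakk> \<Longrightarrow> meet a b = meet b a"
  and join_commute: "\<lbrakk>a \<in> A; b \<in> A\<rbrakk> \<Longrightarrow> join a b = join b a"
  using boolean unfolding boolean_algebra_on_def by blast+

lemma meet_assoc: "\<lbrakk>a \<in> A; b \<in> A; c \<in> A\<rbrakk> \<Longrightarrow> meet (meet a b) c = meet a (meet b c)"
  and meet_join_distrib:
    "\<lbrakk>a \<in> A; b \<in> A; c \<in> A\<rbrakk> \<Longrightarrow> meet a (join b c) = join (meet a b) (meet a c)"
  and join_meet_distrib:
    "\<lbrakk>a \<in> A; b \<in> A; c \<in> A\<rbrakk> \<Longrightarrow> join a (meet b c) = meet (join a b) (join a c)"
  using boolean unfolding boolean_algebra_on_def by blast+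

lemma imp_closed [simp]: "\<lbrakk>a \<in> A; b \<in> A\<rbrakk> \<Longrightarrow> imp a b \<in> A"
  by (subst imp_eq) auto

lemma meet_idem [simp]:
  assumes "a \<in> A"
  shows "meet a a = a"
  using meet_join_distrib[of a a "compl a"] assms by simp

lemma meet_zero [simp]:
  assumes "a \<in> A"
  shows "meet a zero = zero"
  using meet_assoc[of a a "compl a"] assms by simp

lemma meet_absorb:
  assumes "a \<in> A" "b \<in> A"
  shows "meet a (join a b) = a"
  using join_meet_distrib[of a zero b] assms by (simp add: meet_commute[of zero b])

lemma le_refl: "a \<in> A \<Longrightarrow> le a a"
  by (simp add: le_def)

lemma le_trans:
  assumes "le a b" "le b c" "a \<in> A" "b \<in> A" "c \<in> A"
  shows "le a c"
  using assms meet_assoc[of a b c] by (simp add: le_def)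

lemma meet_le1:
  assumes "a \<in> A" "b \<in> A"
  shows "le (meet a b) a"
  using assms by (metis le_def meet_assoc meet_closed meet_commute meet_idem)

lemma meet_le2:
  assumes "a \<in> A" "b \<in> A"
  shows "le (meet a b) b"
  using assms by (simp add: le_def meet_assoc)

lemma le_meet:
  assumes "le c a" "le c b" "a \<in> A" "b \<in> A" "c \<in> A"
  shows "le c (meet a b)"
  using assms meet_assoc[of c a b] by (simp add: le_def)

lemma le_join1: "\<lbrakk>a \<in> A; b \<in> A\<rbrakk> \<Longrightarrow> le a (join a b)"
  by (simp add: le_def meet_absorb)

lemma le_join2: "\<lbrakk>a \<in> A; b \<in> A\<rbrakk> \<Longrightarrow> le b (join a b)"
  by (metis le_join1 join_commute)

lemma join_le:
  assumes "le a c" "le b c" "a \<in> A" "b \<in> A" "c \<in> A"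
  shows "le (join a b) c"
  using assms meet_join_distrib[of c a b] by (simp add: le_def meet_commute)

lemma zero_le: "a \<in> A \<Longrightarrow> le zero a"
  by (simp add: le_def meet_commute[of zero a])

lemma one_le_iff: "a \<in> A \<Longrightarrow> le one a \<longleftrightarrow> a = one"
  by (auto simp: le_def meet_commute[of one a])

text \<open>
  Splitting \<open>c\<close> along \<open>a\<close> and its complement gives one direction; distributing \<open>a\<close> over
  \<open>\<sim>a \<or> b\<close>, where \<open>a \<and> \<sim>a\<close> vanishes, gives the other.
\<close>

lemma residuation:
  assumes [simp]: "a \<in> A" "b \<in> A" "c \<in> A"
  shows "le c (imp a b) \<longleftrightarrow> le (meet c a) b"
proof
  assume le: "le (meet c a) b"
  have "c = join (meet c a) (meet c (compl a))"
    using meet_join_distrib[of c a "compl a"] by simp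
  moreover have "le (meet c a) (imp a b)"
    using le_trans[OF le le_join2[of "compl a" b]] by (simp add: imp_eq[of a b])
  moreover have "le (meet c (compl a)) (imp a b)"
    using le_trans[OF meet_le2[of c "compl a"] le_join1[of "compl a" b]]
    by (simp add: imp_eq[of a b])
  ultimately show "le c (imp a b)"
    using join_le[of "meet c a" "imp a b" "meet c (compl a)"] by simp
next
  assume le: "le c (imp a b)"
  have "meet a (imp a b) = join zero (meet a b)"
    using meet_join_distrib[of a "compl a" b] by (simp add: imp_eq[of a b])
  also have "\<dots> = meet a b"
    by (simp add: join_commute[of zero])
  finally have le_b: "le (meet a (imp a b)) b"
    by (simp add: meet_le2)
  have "le (meet c a) (meet a (imp a b))"
    by (intro le_meet meet_le2 le_trans[OF meet_le1 le]) simp_all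
  then show "le (meet c a) b"
    by (rule le_trans[OF _ le_b]) simp_all
qed

lemma imp_eq_one_iff: "\<lbrakk>a \<in> A; b \<in> A\<rbrakk> \<Longrightarrow> imp a b = one \<longleftrightarrow> le a b"
  using residuation[of a b one] by (simp add: one_le_iff meet_commute[of one a])

lemma modus_ponens:
  assumes "imp one b = one" "b \<in> A"
  shows "b = one"
  using assms by (simp add: imp_eq_one_iff one_le_iff)

end

section \<open>Values of the axioms and of derivable formulas\<close>

lemma op_of_eqI: "\<lbrakk>ordinary A f; a \<in> A; b \<in> A; c \<in> f a b\<rbrakk> \<Longrightarrow> c = op_of f a b"
  unfolding ordinary_def op_of_def is_singleton_def by fastforce

locale rn_valuation =
  fixes L :: logic and M :: "'a multialg" and zero one :: 'a and \<nu> :: "'v form \<Rightarrow> 'a"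
  assumes reduct: "boolean_reduct M zero one"
    and conditions: "algebra_conditions L M zero one"
    and restricted: "\<nu> \<in> restricted_valuations L M zero"
begin

sublocale carrier_boolean_algebra "univ M" "op_of (and_op M)" "op_of (or_op M)"
  "op_of (imp_op M)" zero one
  using reduct by unfold_locales (simp_all add: boolean_reduct_def Let_def)

lemma valuation: "valuation M \<nu>"
  using restricted by (simp add: restricted_valuations_def Let_def)

lemma val_closed [simp]: "\<nu> \<psi> \<in> univ M"
  using valuation by (simp add: valuation_def)

lemma val_Or: "\<nu> (\<alpha> \<^bold>\<or> \<beta>) = op_of (or_op M) (\<nu> \<alpha>) (\<nu> \<beta>)"
  and val_And: "\<nu> (\<alpha> \<^bold>\<and> \<beta>) = op_of (and_op M) (\<nu> \<alpha>) (\<nu> \<beta>)"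
  and val_Imp: "\<nu> (\<alpha> \<^bold>\<rightarrow> \<beta>) = op_of (imp_op M) (\<nu> \<alpha>) (\<nu> \<beta>)"
proof -
  have "ordinary (univ M) (or_op M)" "ordinary (univ M) (and_op M)" "ordinary (univ M) (imp_op M)"
    using reduct unfolding boolean_reduct_def Let_def by blast+
  moreover have "\<nu> (\<alpha> \<^bold>\<or> \<beta>) \<in> or_op M (\<nu> \<alpha>) (\<nu> \<beta>)" "\<nu> (\<alpha> \<^bold>\<and> \<beta>) \<in> and_op M (\<nu> \<alpha>) (\<nu> \<beta>)"
    "\<nu> (\<alpha> \<^bold>\<rightarrow> \<beta>) \<in> imp_op M (\<nu> \<alpha>) (\<nu> \<beta>)"
    using valuation unfolding valuation_def by blast+
  ultimately show "\<nu> (\<alpha> \<^bold>\<or> \<beta>) = op_of (or_op M) (\<nu> \<alpha>) (\<nu> \<beta>)"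
    "\<nu> (\<alpha> \<^bold>\<and> \<beta>) = op_of (and_op M) (\<nu> \<alpha>) (\<nu> \<beta>)"
    "\<nu> (\<alpha> \<^bold>\<rightarrow> \<beta>) = op_of (imp_op M) (\<nu> \<alpha>) (\<nu> \<beta>)"
    by (simp_all add: op_of_eqI[OF _ val_closed val_closed])
qed

lemma val_Up_meet: "op_of (and_op M) (op_of (and_op M) (\<nu> \<alpha>) (\<nu> \<beta>)) (\<nu> (\<alpha> \<^bold>\<up> \<beta>)) = zero"
  using conditions valuation by (simp add: algebra_conditions_def valuation_def Let_def)

lemma val_Neg_join: "op_of (or_op M) (\<nu> \<alpha>) (\<nu> (\<^bold>\<not> \<alpha>)) = one"
  using conditions valuation by (simp add: algebra_conditions_def valuation_def Let_def)

lemma val_Up_commute: "\<nu> (\<alpha> \<^bold>\<up> \<beta>) = \<nu> (\<beta> \<^bold>\<up> \<alpha>)"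
  and val_Up_Neg: "\<nu> (\<alpha> \<^bold>\<up> \<^bold>\<not> \<alpha>) = compl (\<nu> (\<alpha> \<^bold>\<and> \<^bold>\<not> \<alpha>))"
  and val_ci: "L = NbIci \<Longrightarrow> \<nu> (\<^bold>\<not> (\<alpha> \<^bold>\<up> \<^bold>\<not> \<alpha>)) = \<nu> (\<alpha> \<^bold>\<and> \<^bold>\<not> \<alpha>)"
  and val_cl: "L = NbIcl \<Longrightarrow> \<nu> (\<alpha> \<^bold>\<up> \<^bold>\<not> \<alpha>) = \<nu> (\<^bold>\<not> (\<alpha> \<^bold>\<and> \<^bold>\<not> \<alpha>))"
proof -
  have "\<forall>\<alpha> \<beta>. \<nu> (\<alpha> \<^bold>\<up> \<beta>) = \<nu> (\<beta> \<^bold>\<up> \<alpha>)"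
    using restricted by (simp add: restricted_valuations_def Let_def)
  then show "\<nu> (\<alpha> \<^bold>\<up> \<beta>) = \<nu> (\<beta> \<^bold>\<up> \<alpha>)" by blast
  show "\<nu> (\<alpha> \<^bold>\<up> \<^bold>\<not> \<alpha>) = compl (\<nu> (\<alpha> \<^bold>\<and> \<^bold>\<not> \<alpha>))"
    using restricted by (simp add: restricted_valuations_def Let_def val_And)
  show "\<nu> (\<^bold>\<not> (\<alpha> \<^bold>\<up> \<^bold>\<not> \<alpha>)) = \<nu> (\<alpha> \<^bold>\<and> \<^bold>\<not> \<alpha>)" if "L = NbIci"
    using restricted that by (simp add: restricted_valuations_def Let_def val_And)
  show "\<nu> (\<alpha> \<^bold>\<up> \<^bold>\<not> \<alpha>) = \<nu> (\<^bold>\<not> (\<alpha> \<^bold>\<and> \<^bold>\<not> \<alpha>))" if "L = NbIcl"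
    using restricted that unfolding restricted_valuations_def Let_def by blast
qed

lemma val_Imp_one_iff: "\<nu> (\<alpha> \<^bold>\<rightarrow> \<beta>) = one \<longleftrightarrow> le (\<nu> \<alpha>) (\<nu> \<beta>)"
  by (simp add: val_Imp imp_eq_one_iff)

lemma le_val_Imp_iff:
  "c \<in> univ M \<Longrightarrow> le c (\<nu> (\<alpha> \<^bold>\<rightarrow> \<beta>)) \<longleftrightarrow> le (op_of (and_op M) c (\<nu> \<alpha>)) (\<nu> \<beta>)"
  by (simp add: val_Imp residuation)

text \<open>
  Uncurrying by residuation leaves, for each implicational axiom, an inequality whose left-hand side
  is the meet of all its antecedents.
\<close>

lemma nbI_axiom_value:
  assumes "nbI_axiom \<psi>"
  shows "\<nu> \<psi> = one"
  using assms
proof cases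
  case (Ax1 \<alpha> \<beta>)
  show ?thesis
    unfolding Ax1 by (simp add: val_Imp_one_iff le_val_Imp_iff meet_le1)
next
  case (Ax2 \<alpha> \<beta> \<gamma>)
  let ?a = "\<nu> \<alpha>" and ?b = "\<nu> \<beta>" and ?c = "\<nu> \<gamma>"
  let ?p = "\<nu> (\<alpha> \<^bold>\<rightarrow> (\<beta> \<^bold>\<rightarrow> \<gamma>))" and ?q = "\<nu> (\<alpha> \<^bold>\<rightarrow> \<beta>)"
  let ?m = "op_of (and_op M) (op_of (and_op M) ?p ?q) ?a"
  have pq: "le ?m (op_of (and_op M) ?p ?q)" and a: "le ?m ?a"
    by (simp_all add: meet_le1 meet_le2)
  have p: "le ?m ?p" and q: "le ?m ?q"
    by (rule le_trans[OF pq]; simp add: meet_le1 meet_le2)+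
  \<comment> \<open>Modus ponens below \<open>m\<close>: since \<open>m \<le> a\<close>, an implication from \<open>a\<close> above \<open>m\<close> puts its
      consequent above \<open>m\<close> too.\<close>
  have mp: "le ?m (\<nu> \<delta>)" if "le ?m (\<nu> (\<epsilon> \<^bold>\<rightarrow> \<delta>))" "le ?m (\<nu> \<epsilon>)" for \<epsilon> \<delta>
    using that unfolding le_def[of _ "\<nu> \<epsilon>"] by (simp add: le_val_Imp_iff)
  have "le ?m ?c"
    using mp[OF mp[OF p a] mp[OF q a]] .
  then show ?thesis
    unfolding Ax2 by (simp add: val_Imp_one_iff le_val_Imp_iff)
next
  case (Ax3 \<alpha> \<beta>)
  show ?thesis
    unfolding Ax3 by (simp add: val_Imp_one_iff le_val_Imp_iff val_And le_refl)
next
  case (Ax4 \<alpha> \<beta>)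
  show ?thesis
    unfolding Ax4 by (simp add: val_Imp_one_iff val_And meet_le1)
next
  case (Ax5 \<alpha> \<beta>)
  show ?thesis
    unfolding Ax5 by (simp add: val_Imp_one_iff val_And meet_le2)
next
  case (Ax6 \<alpha> \<beta>)
  show ?thesis
    unfolding Ax6 by (simp add: val_Imp_one_iff val_Or le_join1)
next
  case (Ax7 \<beta> \<alpha>)
  show ?thesis
    unfolding Ax7 by (simp add: val_Imp_one_iff val_Or le_join2)
next
  case (Ax8 \<alpha> \<gamma> \<beta>)
  let ?p = "\<nu> (\<alpha> \<^bold>\<rightarrow> \<gamma>)" and ?q = "\<nu> (\<beta> \<^bold>\<rightarrow> \<gamma>)"
  let ?m = "op_of (and_op M) ?p ?q"
  \<comment> \<open>Distributivity splits the disjunction, and each half is handled by its own implication.\<close>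
  have "le (op_of (and_op M) ?m (\<nu> \<alpha>)) (\<nu> \<gamma>)" "le (op_of (and_op M) ?m (\<nu> \<beta>)) (\<nu> \<gamma>)"
    by (simp_all flip: le_val_Imp_iff add: meet_le1 meet_le2)
  then have "le (op_of (and_op M) ?m (\<nu> (\<alpha> \<^bold>\<or> \<beta>))) (\<nu> \<gamma>)"
    by (simp add: val_Or meet_join_distrib join_le)
  then show ?thesis
    unfolding Ax8 by (simp add: val_Imp_one_iff le_val_Imp_iff)
next
  case (Ax9 \<alpha> \<beta>)
  let ?a = "\<nu> \<alpha>" and ?i = "\<nu> (\<alpha> \<^bold>\<rightarrow> \<beta>)"
  have "le (compl ?a) ?i"
    by (simp add: val_Imp imp_eq[of ?a "\<nu> \<beta>"] le_join1)
  then have "le (compl ?a) (op_of (or_op M) ?i ?a)"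
    by (rule le_trans[OF _ le_join1]) simp_all
  then have "le (op_of (or_op M) ?a (compl ?a)) (op_of (or_op M) ?i ?a)"
    by (simp add: join_le le_join2 del: join_compl)
  then show ?thesis
    unfolding Ax9 by (simp add: val_Or one_le_iff)
next
  case (Ip \<alpha> \<beta> \<gamma>)
  have "op_of (and_op M) (op_of (and_op M) (\<nu> (\<alpha> \<^bold>\<up> \<beta>)) (\<nu> \<alpha>)) (\<nu> \<beta>) = zero"
    using val_Up_meet[of \<alpha> \<beta>] by (simp add: meet_assoc meet_commute[of "\<nu> (\<alpha> \<^bold>\<up> \<beta>)"])
  then show ?thesis
    unfolding Ip by (simp add: val_Imp_one_iff le_val_Imp_iff zero_le)
next
  case (Comm \<alpha> \<beta>)
  show ?thesis
    unfolding Comm using val_Up_commute[of \<alpha> \<beta>] by (simp add: val_Imp_one_iff le_refl)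
next
  case (Ax11 \<alpha>)
  show ?thesis
    unfolding Ax11 by (simp add: val_Or[of \<alpha>] val_Neg_join)
qed

lemma axiom_value:
  assumes "is_axiom L \<psi>"
  shows "\<nu> \<psi> = one"
  using assms
proof cases
  case nbI
  then show ?thesis by (rule nbI_axiom_value)
next
  case (ciw \<alpha>)
  then show ?thesis
    by (simp add: val_Or[of "\<alpha> \<^bold>\<up> \<^bold>\<not> \<alpha>"] val_Up_Neg join_commute[of "compl _"])
next
  case (ci \<alpha>)
  then show ?thesis by (simp add: val_Imp_one_iff val_ci le_refl)
next
  case (cl \<alpha>)
  then show ?thesis by (simp add: val_Imp_one_iff val_cl le_refl)
qed

lemma derivation_value:
  assumes deriv: "derivation L \<Gamma> \<phi>s" and prem: "\<forall>\<gamma>\<in>\<Gamma>. \<nu> \<gamma> = one"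
  shows "i < length \<phi>s \<Longrightarrow> \<nu> (\<phi>s ! i) = one"
proof (induction i rule: less_induct)
  case (less i)
  consider "\<phi>s ! i \<in> \<Gamma>" | "is_axiom L (\<phi>s ! i)"
    | j k where "j < i" "k < i" "\<phi>s ! k = (\<phi>s ! j \<^bold>\<rightarrow> \<phi>s ! i)"
    using deriv less.prems unfolding derivation_def by blast
  then show ?case
  proof cases
    case 1
    then show ?thesis using prem by blast
  next
    case 2
    then show ?thesis by (rule axiom_value)
  next
    case 3
    then have "\<nu> (\<phi>s ! j) = one" "\<nu> (\<phi>s ! j \<^bold>\<rightarrow> \<phi>s ! i) = one"
      using less.IH[of j] less.IH[of k] less.prems by simp_all
    then show ?thesis
      using modus_ponens[of "\<nu> (\<phi>s ! i)"] by (simp add: val_Imp)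
  qed
qed

end

theorem theorem12:
  fixes L :: logic and \<Gamma> :: "'v::countable form set" and \<phi> :: "'v form"
  assumes "derives L \<Gamma> \<phi>"
  shows "entails TYPE('a) L \<Gamma> \<phi>"
  unfolding entails_def
proof (intro allI impI ballI)
  fix M :: "'a multialg" and D :: "'a set" and F :: "('v form \<Rightarrow> 'a) set" and \<nu>
  assume "rnmatrix L M D F" and \<nu>: "\<nu> \<in> F" and prem: "\<forall>\<gamma>\<in>\<Gamma>. \<nu> \<gamma> \<in> D"
  then obtain zero one where reduct: "boolean_reduct M zero one"
    and cond: "algebra_conditions L M zero one"
    and D: "D = {one}" and F: "F = restricted_valuations L M zero"
    unfolding rnmatrix_def by blast
  interpret rn_valuation L M zero one \<nu>
    using reduct cond \<nu> F by unfold_locales simp_all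
  obtain \<phi>s where \<phi>s: "\<phi>s \<noteq> []" "derivation L \<Gamma> \<phi>s" "last \<phi>s = \<phi>"
    using assms unfolding derives_def by blast
  have "\<nu> (\<phi>s ! (length \<phi>s - 1)) = one"
    using derivation_value[OF \<phi>s(2), of "length \<phi>s - 1"] prem \<phi>s(1) D by simp
  then show "\<nu> \<phi> \<in> D"
    using \<phi>s D by (simp add: last_conv_nth)
qed

end
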